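(* Let $\mathcal{P}$ be the regular icosahedron, centered at the origin and scaled so that its midsphere (the sphere touching the midpoint of every edge) is the unit sphere $\mathbb{S}^2\subset\mathbb{R}^3$. For $\delta\in[0,\pi/2]$ let $L(\delta)$ be the configuration of the thirty lines obtained from the lines containing the thirty edges of $\mathcal{P}$ by rotating each line, inside the plane tangent to $\mathbb{S}^2$ at the midpoint $m$ of that edge, about the axis through the origin and $m$ by the angle $\delta$, all lines being rotated in the same sense (counterclockwise as viewed from the tip of the axis, i.e. from outside the sphere). Let $d(\delta)$ denote the minimal distance between two distinct lines of $L(\delta)$. Then the maximum of $d(\delta)$ over $\delta\in[0,\pi/2]$ is attained at the angle $$\delta_{\max}=\arctan\bigl(\sqrt{t_0}\bigr),$$ where $t_0\simeq 0.694356$ is a root of the polynomial $5t^6-80t^5+190t^3-4t^2-84t+9$, all of whose roots are real; approximately $\delta_{\max}\simeq 0.694707$. The square of the minimal distance at $\delta_{\max}$ is approximately $d(\delta_{\max})^2\simeq 0.0429216$, and the corresponding cylinder radius $r=\frac{d(\delta_{\max})}{2-d(\delta_{\max})}$ is approximately $0.115558$.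
   Context: Each line of $L(\delta)$ is tangent to the unit sphere (at the corresponding edge midpoint). At $\delta=0$ the lines contain the edges of the icosahedron; at $\delta=\pi/2$ they contain the edges of the dual dodecahedron (with the same midsphere). The rotation is carried out so that $L(\delta)$ is invariant under the group of proper (orientation-preserving) symmetries of the icosahedron. If the lines of a configuration tangent to the unit sphere have minimal pairwise distance $d$, then congruent infinite right circular cylinders having these lines as rulings, touching the unit sphere from outside and pairwise non-overlapping, can have common radius at most $r=d/(2-d)$; this is the cylinder radius referred to in the statement. *)

theory Defs
  imports "HOL-Analysis.Analysis" "HOL-Computational_Algebra.Polynomial"
begin

definition gold :: real where "gold = (1 + sqrt 5) / 2"

text \<open>Vertices of the regular icosahedron centred at the origin: the cyclic permutations
  of (0, +-1, +-gold), scaled by 1/gold so that the midsphere (through the edge midpoints)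
  is the unit sphere.  (Edge length is then 2/gold, midradius 1.)\<close>
definition ico_vertices :: "(real^3) set" where
  "ico_vertices = (\<lambda>x. (1 / gold) *\<^sub>R x) `
     ({vector [0, a, b * gold] | a b. a \<in> {-1, 1} \<and> b \<in> {-1, 1}} \<union>
      {vector [a, b * gold, 0] | a b. a \<in> {-1, 1} \<and> b \<in> {-1, 1}} \<union>
      {vector [b * gold, 0, a] | a b. a \<in> {-1, 1} \<and> b \<in> {-1, 1}})"

definition ico_edges :: "((real^3, real^3) prod) set" where
  "ico_edges = {(v, w). v \<in> ico_vertices \<and> w \<in> ico_vertices \<and> dist v w = 2 / gold}"

text \<open>Rotation of x by angle theta about the axis through the origin with direction n
  (Rodrigues' formula; counterclockwise when viewed from the tip of n).\<close>
definition rot_axis :: "real^3 \<Rightarrow> real \<Rightarrow> real^3 \<Rightarrow> real^3" where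
  "rot_axis n \<theta> x = (let e = (1 / norm n) *\<^sub>R n in
     cos \<theta> *\<^sub>R x + sin \<theta> *\<^sub>R cross3 e x + ((1 - cos \<theta>) * (e \<bullet> x)) *\<^sub>R e)"

text \<open>The line containing edge (v,w), rotated by delta about the axis through the origin
  and the edge midpoint m (the rotation fixes m, so the line stays in the tangent plane at m).\<close>
definition rotated_edge_line :: "real \<Rightarrow> real^3 \<Rightarrow> real^3 \<Rightarrow> (real^3) set" where
  "rotated_edge_line \<delta> v w = (let m = midpoint v w in
     {m + t *\<^sub>R rot_axis m \<delta> (v - w) | t. True})"

definition Lconf :: "real \<Rightarrow> (real^3) set set" where
  "Lconf \<delta> = {rotated_edge_line \<delta> v w | v w. (v, w) \<in> ico_edges}"

definition dmin :: "real \<Rightarrow> real" where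
  "dmin \<delta> = Inf {setdist A B | A B. A \<in> Lconf \<delta> \<and> B \<in> Lconf \<delta> \<and> A \<noteq> B}"

definition P0 :: "real poly" where
  "P0 = [:9, -84, -4, 190, 0, -80, 5:]"

end

theory Submission
  imports Defs
begin

text \<open>
  Put \<open>t = tan\<^sup>2 \<delta>\<close>.  The squared distance of the lines of two edges sharing a vertex and lying in
  a common face is \<open>f\<^sub>1 = 4 t / ((9 gold + 6) + (20 gold + 14) t + (11 gold + 7) t\<^sup>2)\<close>, and that of
  two edges with orthogonal midpoints is \<open>f\<^sub>2 = (1 - t)\<^sup>2 / (1 + t + t\<^sup>2)\<close>.  The equation
  \<open>f\<^sub>1 = f\<^sub>2\<close> is \<open>(t + 1) * cubic t = 0\<close>, where \<open>cubic\<close> has coefficients in the golden field and its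
  norm is \<open>P0\<close>; this gives \<open>t\<^sub>0\<close>.  On \<open>[t\<^sub>0, 1 / t\<^sub>0]\<close> one has \<open>f\<^sub>2(t) \<le> f\<^sub>2(t\<^sub>0)\<close>, and elsewhere
  \<open>f\<^sub>1(t) \<le> f\<^sub>1(t\<^sub>0)\<close>, so the common value bounds the minimal distance for every angle.  At \<open>t\<^sub>0\<close> all
  other pairs of lines are strictly further apart; there are only eleven types of pairs.
\<close>

lemma gold_sq: "gold * gold = gold + 1"
  by (simp add: gold_def field_simps)

lemma gold_bounds: "1.61803398 < gold" "gold < 1.61803399"
proof -
  have "2.23606796 < sqrt 5" by (rule real_less_rsqrt) (simp add: power2_eq_square)
  moreover have "sqrt 5 < 2.23606798" by (rule real_less_lsqrt) (simp_all add: power2_eq_square)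
  ultimately show "1.61803398 < gold" "gold < 1.61803399" by (simp_all add: gold_def)
qed

lemma inverse_gold: "1 / gold = gold - 1"
  using gold_sq gold_bounds by (simp add: field_simps)


section \<open>The polynomial and its root\<close>

definition cubic :: "real \<Rightarrow> real" where
  "cubic t = (11 * gold + 7) * t ^ 3 - (13 * gold + 11) * t\<^sup>2 - (7 * gold + 8) * t + (9 * gold + 6)"

lemma cubic_root: "\<exists>t. 0.6943558 < t \<and> t < 0.6943559 \<and> cubic t = 0"
proof -
  \<comment> \<open>At a numeral argument this is affine in \<open>gold\<close>, so the interval for
    \<open>gold\<close> decides the sign by linear arithmetic.\<close>
  have split: "cubic t = (7 * t ^ 3 - 11 * t\<^sup>2 - 8 * t + 6) + (11 * t ^ 3 - 13 * t\<^sup>2 - 7 * t + 9) * gold" for t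
    by (simp add: cubic_def algebra_simps)
  have 1: "cubic 0.6943558 > 0" and 2: "cubic 0.6943559 < 0"
    unfolding split using gold_bounds by (simp_all add: power_divide)
  have "\<exists>t\<ge>0.6943558. t \<le> 0.6943559 \<and> cubic t = 0"
    by (rule IVT2') (use 1 2 in \<open>auto simp: cubic_def intro!: continuous_intros\<close>)
  then show ?thesis using 1 2 by (metis less_irrefl order_le_less)
qed

lemma P0_eq: "poly P0 t = 5 * t ^ 6 - 80 * t ^ 5 + 190 * t ^ 3 - 4 * t\<^sup>2 - 84 * t + 9" for t :: real
  by (simp add: P0_def algebra_simps eval_nat_numeral)

text \<open>\<open>P0\<close> is the product of \<open>cubic\<close> and its conjugate under \<open>sqrt 5 \<mapsto> - sqrt 5\<close>.\<close>

lemma cubic_root_imp_P0: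
  assumes "cubic t = 0" shows "poly P0 t = 0"
proof -
  define a b where "a = 7 * t ^ 3 - 11 * t\<^sup>2 - 8 * t + 6" and "b = 11 * t ^ 3 - 13 * t\<^sup>2 - 7 * t + 9"
  have "a = - gold * b" using assms by (simp add: cubic_def a_def b_def algebra_simps)
  \<comment> \<open>The left side is the norm of \<open>a + b * gold\<close>, that is, its product
    with \<open>a + b * (1 - gold)\<close>.\<close>
  then have "a\<^sup>2 + a * b - b\<^sup>2 = b\<^sup>2 * (gold * gold - gold - 1)"
    by (simp add: power2_eq_square algebra_simps)
  also have "\<dots> = 0" by (simp add: gold_sq)
  finally have "a\<^sup>2 + a * b - b\<^sup>2 = 0" .
  moreover have "poly P0 t = a\<^sup>2 + a * b - b\<^sup>2"
    unfolding P0_eq a_def b_def by algebra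
  ultimately show ?thesis by simp
qed

text \<open>Sign changes on six pairwise disjoint intervals yield six distinct real roots; a
  polynomial of degree 6 has no room for further complex ones.\<close>

lemma P0_roots_real:
  assumes "poly (map_poly complex_of_real P0) z = 0" shows "z \<in> \<real>"
proof -
  have root: "\<exists>x\<ge>a. x \<le> b \<and> poly P0 x = 0"
    if "a \<le> b" "poly P0 a * poly P0 b \<le> 0" for a b
  proof (cases "poly P0 a \<le> 0")
    case True
    show ?thesis
    proof (cases "poly P0 b \<ge> 0")
      case True
      with \<open>poly P0 a \<le> 0\<close> that show ?thesis
        by (intro IVT') (auto intro!: continuous_intros)
    next
      case False
      with that(2) \<open>poly P0 a \<le> 0\<close> have "poly P0 a = 0" by (auto simp: mult_le_0_iff)
      then show ?thesis using that(1) by blast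
    qed
  next
    case False
    with that(2) have "poly P0 b \<le> 0" by (auto simp: mult_le_0_iff)
    with False that(1) show ?thesis by (intro IVT2') (auto intro!: continuous_intros)
  qed
  obtain r1 where r1: "-2 \<le> r1" "r1 \<le> -1" "poly P0 r1 = 0" using root[of "-2" "-1"] by (auto simp: P0_eq)
  obtain r2 where r2: "-0.9 \<le> r2" "r2 \<le> 0" "poly P0 r2 = 0" using root[of "-0.9" 0] by (auto simp: P0_eq power_divide)
  obtain r3 where r3: "0.1 \<le> r3" "r3 \<le> 0.2" "poly P0 r3 = 0" using root[of "0.1" "0.2"] by (auto simp: P0_eq power_divide)
  obtain r4 where r4: "0.6 \<le> r4" "r4 \<le> 0.9" "poly P0 r4 = 0" using root[of "0.6" "0.9"] by (auto simp: P0_eq power_divide)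
  obtain r5 where r5: "1 \<le> r5" "r5 \<le> 2" "poly P0 r5 = 0" using root[of "1" "2"] by (auto simp: P0_eq)
  obtain r6 where r6: "3 \<le> r6" "r6 \<le> 16" "poly P0 r6 = 0" using root[of "3" "16"] by (auto simp: P0_eq)
  define p where "p = map_poly complex_of_real P0"
  have dp: "degree p = 6" unfolding p_def P0_def by (simp add: degree_map_poly)
  then have p0: "p \<noteq> 0" by auto
  have ev: "poly p (complex_of_real x) = complex_of_real (poly P0 x)" for x
    unfolding p_def P0_def by (simp add: map_poly_pCons)
  define R where "R = {r1, r2, r3, r4, r5, r6}"
  have "card R = 6" using r1 r2 r3 r4 r5 r6 by (auto simp: R_def)
  then have cR: "card (complex_of_real ` R) = 6" by (subst card_image) (auto simp: inj_on_def)
  have sub: "complex_of_real ` R \<subseteq> {x. poly p x = 0}"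
    using r1 r2 r3 r4 r5 r6 by (auto simp: R_def ev)
  have "card {x. poly p x = 0} \<le> 6" using card_poly_roots_bound[OF p0] dp by simp
  then have "complex_of_real ` R = {x. poly p x = 0}"
    using sub cR poly_roots_finite[OF p0] by (intro card_subset_eq) (auto dest: card_mono)
  moreover have "z \<in> {x. poly p x = 0}" using assms by (simp add: p_def)
  ultimately have "z \<in> complex_of_real ` R" by blast
  then show ?thesis by auto
qed

text \<open>By monotonicity of \<open>arctan\<close> it suffices to compare \<open>sqrt t\<close>
  with the tangents of 0.694706 and 0.694708, which are estimated through Taylor polynomials of sine
  and cosine.\<close>

lemma arctan_bounds:
  assumes "0.6943558 < t" "t < 0.6943559"
  shows "\<bar>arctan (sqrt t) - 0.694707\<bar> < 0.000001"
proof -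
  have s: "0.83328 < sqrt t" "sqrt t < 0.8332803"
    by (rule real_less_rsqrt, use assms in \<open>simp add: power2_eq_square\<close>)
      (rule real_less_lsqrt, use assms in \<open>simp_all add: power2_eq_square\<close>)
  \<comment> \<open>The remainders are at most \<open>0.7 ^ 9 / fact 9\<close> and
    \<open>0.7 ^ 10 / fact 10\<close>, both below 0.0000002.\<close>
  have trig: "\<bar>sin x - (x - x^3/6 + x^5/120 - x^7/5040)\<bar> \<le> 0.0000002 \<and>
     \<bar>cos x - (1 - x^2/2 + x^4/24 - x^6/720 + x^8/40320)\<bar> \<le> 0.0000002"
    if x: "0 < x" "x < 0.7" for x :: real
  proof -
    have p: "x ^ 9 \<le> 0.7 ^ 9" "x ^ 10 \<le> 0.7 ^ 10" using x by (auto intro: power_mono)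
    have "\<bar>sin x - (\<Sum>m<9. sin_coeff m * x ^ m)\<bar> \<le> inverse (fact 9) * \<bar>x\<bar> ^ 9"
      by (rule Maclaurin_sin_bound)
    moreover have "(\<Sum>m<9. sin_coeff m * x ^ m) = x - x^3/6 + x^5/120 - x^7/5040"
      by (simp add: lessThan_nat_numeral sin_coeff_def fact_numeral)
    ultimately have 1: "\<bar>sin x - (x - x^3/6 + x^5/120 - x^7/5040)\<bar> \<le> 0.0000002"
      using p(1) x by (simp add: fact_numeral power_divide)
    obtain u where u: "cos x = (\<Sum>m<10. cos_coeff m * x ^ m) + cos (u + 1/2 * real 10 * pi) / fact 10 * x ^ 10"
      using Maclaurin_cos_expansion[of x 10] by blast
    have "\<bar>cos (u + 1/2 * real 10 * pi)\<bar> / fact 10 \<le> 1 / fact 10"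
      by (intro divide_right_mono) auto
    then have "\<bar>cos (u + 1/2 * real 10 * pi) / fact 10 * x ^ 10\<bar> \<le> 1 / fact 10 * x ^ 10"
      unfolding abs_mult abs_divide using x by (intro mult_mono) (auto simp del: fact_numeral)
    moreover have "(\<Sum>m<10. cos_coeff m * x ^ m) = 1 - x^2/2 + x^4/24 - x^6/720 + x^8/40320"
      by (simp add: lessThan_nat_numeral cos_coeff_def fact_numeral)
    moreover have "1 / fact 10 * x ^ 10 \<le> 0.0000002"
      using p(2) by (simp add: fact_numeral power_divide)
    ultimately have 2: "\<bar>cos x - (1 - x^2/2 + x^4/24 - x^6/720 + x^8/40320)\<bar> \<le> 0.0000002"
      unfolding u by linarith
    from 1 2 show ?thesis by blast
  qed
  have "tan (0.694706::real) < 0.83328"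
  proof -
    have c: "cos (0.694706::real) > 0" by (rule cos_gt_zero_pi) (use pi_gt3 in auto)
    have "sin (0.694706::real) < 0.83328 * cos 0.694706"
      using trig[of "0.694706", unfolded abs_le_iff] by (simp add: power_divide)
    then show ?thesis using c by (simp add: tan_def field_simps)
  qed
  then have "arctan (tan 0.694706) < arctan (sqrt t)" using s by (simp only: arctan_less_iff)
  moreover have "arctan (tan 0.694706) = 0.694706" by (rule arctan_tan) (use pi_gt3 in auto)
  moreover have "tan (0.694708::real) > 0.8332803"
  proof -
    have c: "cos (0.694708::real) > 0" by (rule cos_gt_zero_pi) (use pi_gt3 in auto)
    have "sin (0.694708::real) > 0.8332803 * cos 0.694708"
      using trig[of "0.694708", unfolded abs_le_iff] by (simp add: power_divide)
    then show ?thesis using c by (simp add: tan_def field_simps)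
  qed
  then have "arctan (tan 0.694708) > arctan (sqrt t)" using s by (simp only: arctan_less_iff)
  moreover have "arctan (tan 0.694708) = 0.694708" by (rule arctan_tan) (use pi_gt3 in auto)
  ultimately show ?thesis by linarith
qed

section \<open>Distance of two skew lines\<close>

text \<open>Projecting onto the common normal \<open>cross3 a b\<close> bounds every distance from
  below (Cauchy-Schwarz); the feet of the common perpendicular attain the bound.\<close>

lemma setdist_lines:
  fixes p q a b :: "real^3"
  assumes n0: "cross3 a b \<noteq> 0"
  shows "setdist {p + t *\<^sub>R a | t. True} {q + t *\<^sub>R b | t. True}
         = \<bar>(p - q) \<bullet> cross3 a b\<bar> / norm (cross3 a b)"
proof -
  define n where "n = cross3 a b"
  have npos: "norm n > 0" using n0 by (simp add: n_def)
  have an: "a \<bullet> n = 0" and bn: "b \<bullet> n = 0"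
    by (simp_all add: n_def dot_cross_self)
  let ?A = "{p + t *\<^sub>R a | t. True}" and ?B = "{q + t *\<^sub>R b | t. True}"
  have low: "\<bar>(p - q) \<bullet> n\<bar> / norm n \<le> dist x y" if xy: "x \<in> ?A" "y \<in> ?B" for x y
  proof -
    obtain s t where "x = p + s *\<^sub>R a" "y = q + t *\<^sub>R b" using xy by blast
    then have "(x - y) \<bullet> n = (p - q) \<bullet> n"
      by (simp add: inner_diff_left inner_add_left an bn)
    moreover have "\<bar>(x - y) \<bullet> n\<bar> \<le> norm (x - y) * norm n"
      by (rule Cauchy_Schwarz_ineq2)
    ultimately show ?thesis using npos by (simp add: dist_norm field_simps)
  qed
  define w where "w = p - q"
  \<comment> \<open>By Cramer's rule these are the coefficients of \<open>w\<close> along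
    \<open>a\<close> and \<open>b\<close> in the basis \<open>n\<close>, \<open>a\<close>,
    \<open>b\<close>; they locate the two feet.\<close>
  define s where "s = w \<bullet> cross3 b n / (n \<bullet> n)"
  define t where "t = w \<bullet> cross3 n a / (n \<bullet> n)"
  have nn: "n \<bullet> n \<noteq> 0" using npos by auto
  have "(n \<bullet> n) *\<^sub>R w = (w \<bullet> n) *\<^sub>R n + (w \<bullet> cross3 b n) *\<^sub>R a + (w \<bullet> cross3 n a) *\<^sub>R b"
    unfolding n_def vec_eq_iff forall_3
    by (simp add: inner_vec_def sum_3 cross3_def) algebra
  then have "(1 / (n \<bullet> n)) *\<^sub>R ((n \<bullet> n) *\<^sub>R w)
      = (1 / (n \<bullet> n)) *\<^sub>R ((w \<bullet> n) *\<^sub>R n + (w \<bullet> cross3 b n) *\<^sub>R a + (w \<bullet> cross3 n a) *\<^sub>R b)"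
    by simp
  then have dec: "w = ((w \<bullet> n) / (n \<bullet> n)) *\<^sub>R n + s *\<^sub>R a + t *\<^sub>R b"
    using nn by (simp add: s_def t_def scaleR_add_right)
  have "dist (p + (- s) *\<^sub>R a) (q + t *\<^sub>R b) = norm (w - s *\<^sub>R a - t *\<^sub>R b)"
    by (simp add: dist_norm w_def algebra_simps)
  also have "w - s *\<^sub>R a - t *\<^sub>R b = ((w \<bullet> n) / (n \<bullet> n)) *\<^sub>R n"
    by (subst dec) (simp add: algebra_simps)
  also have "norm \<dots> = \<bar>w \<bullet> n\<bar> / norm n"
    using npos by (simp add: dot_square_norm power2_eq_square)
  finally have eq: "dist (p + (- s) *\<^sub>R a) (q + t *\<^sub>R b) = \<bar>w \<bullet> n\<bar> / norm n" .
  have "setdist ?A ?B \<le> dist (p + (- s) *\<^sub>R a) (q + t *\<^sub>R b)"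
    by (rule setdist_le_dist) blast+
  moreover have "\<bar>(p - q) \<bullet> n\<bar> / norm n \<le> setdist ?A ?B"
    by (rule le_setdistI) (use low in blast)+
  ultimately show ?thesis using eq by (simp add: n_def w_def)
qed

section \<open>Edges of the icosahedron over the integers of the golden field\<close>

text \<open>A pair \<open>(a, b)\<close> stands for \<open>a + b * gold\<close>.  All edge data, including the cross products,
  lie in this ring, so the finite part of the argument is integer arithmetic.\<close>

type_synonym gint = "int \<times> int"
type_synonym gvec = "gint \<times> gint \<times> gint"
type_synonym gframe = "gvec \<times> gvec \<times> gvec"

fun gadd :: "gint \<Rightarrow> gint \<Rightarrow> gint" where "gadd (a, b) (c, d) = (a + c, b + d)"
fun gsub :: "gint \<Rightarrow> gint \<Rightarrow> gint" where "gsub (a, b) (c, d) = (a - c, b - d)"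
fun gmul :: "gint \<Rightarrow> gint \<Rightarrow> gint" where
  "gmul (a, b) (c, d) = (a * c + b * d, a * d + b * c + b * d)"
fun gval :: "gint \<Rightarrow> real" where "gval (a, b) = of_int a + of_int b * gold"

fun gvadd :: "gvec \<Rightarrow> gvec \<Rightarrow> gvec" where
  "gvadd (x, y, z) (x', y', z') = (gadd x x', gadd y y', gadd z z')"
fun gvsub :: "gvec \<Rightarrow> gvec \<Rightarrow> gvec" where
  "gvsub (x, y, z) (x', y', z') = (gsub x x', gsub y y', gsub z z')"
fun gdot :: "gvec \<Rightarrow> gvec \<Rightarrow> gint" where
  "gdot (x, y, z) (x', y', z') = gadd (gmul x x') (gadd (gmul y y') (gmul z z'))"
fun gcross :: "gvec \<Rightarrow> gvec \<Rightarrow> gvec" where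
  "gcross (x, y, z) (x', y', z') =
     (gsub (gmul y z') (gmul z y'), gsub (gmul z x') (gmul x z'), gsub (gmul x y') (gmul y x'))"
fun vval :: "gvec \<Rightarrow> real^3" where "vval (x, y, z) = vector [gval x, gval y, gval z]"

text \<open>Since the edge midpoint is a unit vector orthogonal to the edge, the line of the edge \<open>(v, w)\<close>
  rotated by \<open>\<delta>\<close> has direction \<open>cos \<delta> (v - w) + sin \<delta> (w \<times> v)\<close>.\<close>

fun edge_frame :: "gvec \<times> gvec \<Rightarrow> gframe" where
  "edge_frame (v, w) = (gvadd v w, gvsub v w, gcross w v)"

type_synonym gform = "gint \<times> gint \<times> gint"
fun gform :: "gform \<Rightarrow> real \<Rightarrow> real \<Rightarrow> real" where
  "gform (p, q, r) c s = gval p * c\<^sup>2 + gval q * (c * s) + gval r * s\<^sup>2"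

text \<open>As quadratic forms in \<open>(cos \<delta>, sin \<delta>)\<close>: twice the triple product of the two directions with
  the difference of the base points, and the inner product of the two directions.  They determine
  the distance of the two lines.\<close>

fun Wform :: "gframe \<Rightarrow> gframe \<Rightarrow> gform" where
  "Wform (m, a, b) (m', a', b') =
     (gdot (gvsub m m') (gcross a a'),
      gdot (gvsub m m') (gvadd (gcross a b') (gcross b a')),
      gdot (gvsub m m') (gcross b b'))"
fun Eform :: "gframe \<Rightarrow> gframe \<Rightarrow> gform" where
  "Eform (m, a, b) (m', a', b') = (gdot a a', gadd (gdot a b') (gdot b a'), gdot b b')"

text \<open>The first component of a frame is the sum of the end points, which keeps it in the ring;
  the factor 1/2 recovers the midpoint.\<close>

fun gline :: "real \<Rightarrow> gframe \<Rightarrow> (real^3) set" where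
  "gline \<delta> (m, a, b) =
     {(1/2) *\<^sub>R vval m + t *\<^sub>R (cos \<delta> *\<^sub>R vval a + sin \<delta> *\<^sub>R vval b) | t. True}"

lemma gval_add [simp]: "gval (gadd x y) = gval x + gval y"
  by (cases x; cases y) (simp add: algebra_simps)
lemma gval_sub [simp]: "gval (gsub x y) = gval x - gval y"
  by (cases x; cases y) (simp add: algebra_simps)
lemma gval_mul [simp]: "gval (gmul x y) = gval x * gval y"
proof (cases x; cases y)
  fix a b c d assume [simp]: "x = (a, b)" "y = (c, d)"
  have "gval x * gval y = of_int (a * c) + of_int (a * d + b * c) * gold + of_int (b * d) * (gold * gold)"
    by (simp add: algebra_simps)
  also have "\<dots> = gval (gmul x y)" unfolding gold_sq by (simp add: algebra_simps)
  finally show ?thesis by simp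
qed

lemma vval_add [simp]: "vval (gvadd x y) = vval x + vval y"
  by (cases x rule: prod_cases3; cases y rule: prod_cases3) (auto simp: vec_eq_iff forall_3)
lemma vval_sub [simp]: "vval (gvsub x y) = vval x - vval y"
  by (cases x rule: prod_cases3; cases y rule: prod_cases3) (auto simp: vec_eq_iff forall_3)
lemma gval_dot [simp]: "gval (gdot x y) = vval x \<bullet> vval y"
  by (cases x rule: prod_cases3; cases y rule: prod_cases3) (auto simp: inner_vec_def sum_3)
lemma vval_cross [simp]: "vval (gcross x y) = cross3 (vval x) (vval y)"
  by (cases x rule: prod_cases3; cases y rule: prod_cases3) (auto simp: vec_eq_iff forall_3 cross3_def)

fun pairs :: "'a list \<Rightarrow> ('a \<times> 'a) list" where
  "pairs [] = []"
| "pairs (x # xs) = map (Pair x) xs @ pairs xs"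

lemma pairs_complete:
  "x \<in> set xs \<Longrightarrow> y \<in> set xs \<Longrightarrow> x \<noteq> y \<Longrightarrow> (x, y) \<in> set (pairs xs) \<or> (y, x) \<in> set (pairs xs)"
  by (induction xs) auto

lemma set_pairs: "(x, y) \<in> set (pairs xs) \<Longrightarrow> x \<in> set xs \<and> y \<in> set xs"
  by (induction xs) auto

text \<open>Since \<open>1 / gold = gold - 1\<close>, the pair \<open>(- a, a)\<close> encodes
  \<open>a / gold\<close>, and the other nonzero coordinate \<open>b * gold\<close> scales to
  \<open>b\<close>.\<close>

definition ico_list :: "gvec list" where
  "ico_list = concat [[((0, 0), (- a, a), (b, 0)), ((- a, a), (b, 0), (0, 0)), ((b, 0), (0, 0), (- a, a))].
     a \<leftarrow> [1, -1], b \<leftarrow> [1, -1]]"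

lemma ico_vertices_eq: "ico_vertices = vval ` set ico_list"
proof -
  have [simp]: "(1 / gold) *\<^sub>R (vector [x, y, z] :: real^3) = vector [x * (gold - 1), y * (gold - 1), z * (gold - 1)]" for x y z
    unfolding inverse_gold[symmetric] by (simp add: vec_eq_iff forall_3)
  have [simp]: "gold * (gold - 1) = 1" using gold_sq by (simp add: algebra_simps)
  have S: "{f a b | a b. a \<in> {-1, 1} \<and> b \<in> {-1, 1}} = {f (-1) (-1), f (-1) 1, f 1 (-1), f 1 1}"
    for f :: "real \<Rightarrow> real \<Rightarrow> real^3" by blast
  show ?thesis
    unfolding ico_vertices_def ico_list_def S
    by (simp add: image_Un insert_commute)
qed

text \<open>\<open>(8, -4)\<close> encodes the squared edge length
  \<open>(2 / gold)\<^sup>2\<close>. Each edge occurs in one orientation only.\<close>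

definition ico_edge_list :: "(gvec \<times> gvec) list" where
  "ico_edge_list = filter (\<lambda>(v, w). gdot (gvsub v w) (gvsub v w) = (8, -4)) (pairs ico_list)"

text \<open>Up to sign, the values of \<open>(Wform, Eform)\<close> on the 435 pairs of edges, found by computation.  The
  third and the eighth entry are the pairs that realise the minimal distance at the optimum.\<close>

definition pair_classes :: "(gform \<times> gform) list" where
  "pair_classes =
   [(((0, 0), (8, 0), (0, 0)), ((2, -2), (0, 0), (4, -2))),
    (((0, 0), (16, -8), (0, 0)), ((6, -4), (0, 0), (2, -2))),
    (((0, 0), (40, -24), (0, 0)), ((4, -2), (0, 0), (-6, 4))),
    (((0, 0), (64, -32), (0, 0)), ((8, -4), (0, 0), (-8, 4))),
    (((8, -8), (-8, 8), (-8, 8)), ((4, -2), (-4, 4), (6, -4))),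
    (((8, -8), (8, -8), (-8, 8)), ((4, -2), (4, -4), (6, -4))),
    (((16, -8), (-32, 24), (-16, 8)), ((6, -4), (8, -4), (-2, 2))),
    (((16, -8), (0, 0), (-16, 8)), ((0, 0), (8, -4), (0, 0))),
    (((16, -8), (32, -24), (-16, 8)), ((6, -4), (-8, 4), (-2, 2))),
    (((24, -16), (-24, 16), (-24, 16)), ((2, -2), (12, -8), (-4, 2))),
    (((24, -16), (24, -16), (-24, 16)), ((2, -2), (-12, 8), (-4, 2)))]"

fun gneg :: "gform \<Rightarrow> gform" where
  "gneg (p, q, r) = (gsub (0, 0) p, gsub (0, 0) q, gsub (0, 0) r)"

text \<open>The signs of the two forms may be adjusted independently because the distance depends
  only on their squares.\<close>

definition in_class :: "gframe \<times> gframe \<Rightarrow> bool" where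
  "in_class = (\<lambda>(f, f'). (let W = Wform f f'; E = Eform f f' in
     list_ex (\<lambda>(W0, E0). (W = W0 \<or> gneg W = W0) \<and> (E = E0 \<or> gneg E = E0)) pair_classes))"

lemma ico_list_norms: "list_all (\<lambda>v. gdot v v = (3, -1)) ico_list"
  by code_simp
text \<open>The values belong to edges, diagonals and antipodal pairs. As they differ as real
  numbers, a real distance of \<open>2 / gold\<close> identifies the encoded value without an appeal
  to the irrationality of \<open>gold\<close>.\<close>

lemma ico_list_dists:
  "list_all (\<lambda>(v, w). gdot (gvsub v w) (gvsub v w) \<in> {(8, -4), (4, 0), (12, -4)}) (pairs ico_list)"
  by code_simp
lemma all_in_class: "list_all in_class (pairs (map edge_frame ico_edge_list))"
  by code_simp

section \<open>The rotated lines and their distances\<close>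

lemma in_ico_edge_list:
  assumes "(x, y) \<in> set ico_edge_list"
  shows "x \<in> set ico_list" "y \<in> set ico_list"
    and "vval x \<bullet> vval x = 3 - gold" "vval y \<bullet> vval y = 3 - gold"
    and "vval x \<bullet> vval y = gold - 1"
proof -
  show x: "x \<in> set ico_list" and y: "y \<in> set ico_list"
    using assms set_pairs[of x y ico_list] by (auto simp: ico_edge_list_def)
  have nrm: "vval v \<bullet> vval v = 3 - gold" if "v \<in> set ico_list" for v
  proof -
    have "gdot v v = (3, -1)" using that ico_list_norms by (auto simp: list_all_iff)
    then have "gval (gdot v v) = 3 - gold" by (simp del: gval_dot)
    then show ?thesis by simp
  qed
  show xx: "vval x \<bullet> vval x = 3 - gold" and yy: "vval y \<bullet> vval y = 3 - gold"
    using nrm x y by auto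
  have "gdot (gvsub x y) (gvsub x y) = (8, -4)"
    using assms by (auto simp: ico_edge_list_def)
  then have "gval (gdot (gvsub x y) (gvsub x y)) = 8 - 4 * gold" by (simp del: gval_dot)
  then show "vval x \<bullet> vval y = gold - 1"
    using xx yy by (simp add: inner_diff_left inner_diff_right inner_commute)
qed

text \<open>The two vectors are orthogonal and equally long, the latter by Lagrange's identity for
  the cross product.\<close>

lemma gline_direction_norm:
  assumes "(x, y) \<in> set ico_edge_list"
  shows "(norm (c *\<^sub>R (vval x - vval y) + s *\<^sub>R cross3 (vval y) (vval x)))\<^sup>2
         = (8 - 4 * gold) * (c\<^sup>2 + s\<^sup>2)"
proof -
  note e = in_ico_edge_list(3-5)[OF assms]
  let ?a = "vval x - vval y" and ?b = "cross3 (vval y) (vval x)"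
  have aa: "?a \<bullet> ?a = 8 - 4 * gold"
    using e by (simp add: inner_diff_left inner_diff_right inner_commute)
  have ab: "?a \<bullet> ?b = 0" by (simp add: inner_diff_left dot_cross_self)
  have "?b \<bullet> ?b = (vval y \<bullet> vval y) * (vval x \<bullet> vval x) - (vval y \<bullet> vval x)\<^sup>2"
    using norm_cross[of "vval y" "vval x"] by (simp add: power2_norm_eq_inner)
  also have "\<dots> = (3 - gold) * (3 - gold) - (gold - 1)\<^sup>2"
    using e by (simp add: inner_commute)
  also have "\<dots> = 8 - 4 * gold" by (simp add: power2_eq_square algebra_simps)
  finally have bb: "?b \<bullet> ?b = 8 - 4 * gold" .
  have "(norm (c *\<^sub>R ?a + s *\<^sub>R ?b))\<^sup>2
      = c * c * (?a \<bullet> ?a) + 2 * (c * s) * (?a \<bullet> ?b) + s * s * (?b \<bullet> ?b)"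
    unfolding power2_norm_eq_inner inner_add_left inner_add_right inner_scaleR_left inner_scaleR_right
      inner_commute[of ?b ?a]
    by (simp add: algebra_simps)
  then show ?thesis unfolding aa ab bb by (simp add: power2_eq_square algebra_simps)
qed

text \<open>The axial term of Rodrigues' formula vanishes: the end points have equal norm, so the
  midpoint is orthogonal to the edge.\<close>

lemma rotated_edge_line_eq:
  assumes "(x, y) \<in> set ico_edge_list"
  shows "rotated_edge_line \<delta> (vval x) (vval y) = gline \<delta> (edge_frame (x, y))"
proof -
  note e = in_ico_edge_list(3-5)[OF assms]
  let ?m = "midpoint (vval x) (vval y)"
  have m: "?m = (1/2) *\<^sub>R (vval x + vval y)" by (simp add: midpoint_def)
  have "(norm ?m)\<^sup>2 = (1/4) * ((vval x + vval y) \<bullet> (vval x + vval y))"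
    unfolding m power2_norm_eq_inner by (simp add: power2_eq_square)
  also have "\<dots> = 1"
    using e by (simp add: inner_add_left inner_add_right inner_commute)
  finally have n1: "norm ?m = 1" using power2_eq_imp_eq[of "norm ?m" 1] by simp
  have o: "?m \<bullet> (vval x - vval y) = 0"
    unfolding m using e by (simp add: inner_add_left inner_diff_right inner_commute[of "vval y" "vval x"])
  have cr: "cross3 ?m (vval x - vval y) = cross3 (vval y) (vval x)"
    unfolding m by (simp add: vec_eq_iff forall_3 cross3_def field_simps)
  have "rot_axis ?m \<delta> (vval x - vval y)
      = cos \<delta> *\<^sub>R (vval x - vval y) + sin \<delta> *\<^sub>R cross3 (vval y) (vval x)"
    by (simp add: rot_axis_def Let_def n1 o cr)
  then show ?thesis by (simp add: rotated_edge_line_def m)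
qed

text \<open>Reversing an edge only negates the direction of its line. This reconciles
  \<open>ico_edges\<close>, which contains both orientations, with the list of single
  orientations.\<close>

lemma rotated_edge_line_commute: "rotated_edge_line \<delta> v w = rotated_edge_line \<delta> w v"
proof -
  have sub: "rotated_edge_line \<delta> v w \<subseteq> rotated_edge_line \<delta> w v" for v w
  proof -
    have "rot_axis m \<delta> (v - w) = - rot_axis m \<delta> (w - v)" for m
      unfolding rot_axis_def Let_def
      by (simp add: vec_eq_iff forall_3 cross3_def inner_diff_right algebra_simps diff_divide_distrib)
    then have "m + t *\<^sub>R rot_axis m \<delta> (v - w) = m + (- t) *\<^sub>R rot_axis m \<delta> (w - v)" for m t
      by simp
    then show ?thesis
      unfolding rotated_edge_line_def Let_def midpoint_sym[of v w] by blast
  qed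
  from sub[of v w] sub[of w v] show ?thesis by simp
qed

lemma edge_dist_iff: "dist (vval x) (vval y) = 2 / gold \<longleftrightarrow>
    gval (gdot (gvsub x y) (gvsub x y)) = 8 - 4 * gold"
proof -
  have two: "2 / gold = 2 * (gold - 1)" using inverse_gold by (simp add: field_simps)
  have g: "2 / gold \<ge> 0" "(2 / gold)\<^sup>2 = 8 - 4 * gold"
    unfolding two using gold_bounds gold_sq by (simp_all add: power2_eq_square algebra_simps)
  have "dist (vval x) (vval y) = 2 / gold \<longleftrightarrow> (dist (vval x) (vval y))\<^sup>2 = (2 / gold)\<^sup>2"
    using g(1) by (simp add: power2_eq_iff_nonneg)
  then show ?thesis unfolding g by (simp add: dist_norm power2_norm_eq_inner)
qed

lemma Lconf_eq: "Lconf \<delta> = gline \<delta> ` set (map edge_frame ico_edge_list)"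
proof
  show "Lconf \<delta> \<subseteq> gline \<delta> ` set (map edge_frame ico_edge_list)"
  proof
    fix A assume "A \<in> Lconf \<delta>"
    then obtain x y where xy: "x \<in> set ico_list" "y \<in> set ico_list"
      and d: "dist (vval x) (vval y) = 2 / gold" and A: "A = rotated_edge_line \<delta> (vval x) (vval y)"
      by (auto simp: Lconf_def ico_edges_def ico_vertices_eq)
    have "x \<noteq> y" using d gold_bounds by auto
    have key: "(v, w) \<in> set ico_edge_list"
      if vw: "(v, w) \<in> set (pairs ico_list)" "dist (vval v) (vval w) = 2 / gold" for v w
    proof -
      have "gdot (gvsub v w) (gvsub v w) \<in> {(8, -4), (4, 0), (12, -4)}"
        using vw(1) ico_list_dists by (auto simp: list_all_iff)
      moreover have "gval (gdot (gvsub v w) (gvsub v w)) = 8 - 4 * gold"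
        using vw(2) edge_dist_iff by blast
      ultimately have "gdot (gvsub v w) (gvsub v w) = (8, -4)"
        using gold_bounds by (auto simp del: gval_dot)
      then show ?thesis using vw(1) by (simp add: ico_edge_list_def)
    qed
    from pairs_complete[OF xy \<open>x \<noteq> y\<close>] show "A \<in> gline \<delta> ` set (map edge_frame ico_edge_list)"
    proof
      assume "(x, y) \<in> set (pairs ico_list)"
      then have e: "(x, y) \<in> set ico_edge_list" using key d by blast
      then show ?thesis unfolding A rotated_edge_line_eq[OF e] set_map by blast
    next
      assume "(y, x) \<in> set (pairs ico_list)"
      then have e: "(y, x) \<in> set ico_edge_list" using key d by (simp add: dist_commute)
      then show ?thesis
        unfolding A rotated_edge_line_commute[of \<delta> "vval x"] rotated_edge_line_eq[OF e] set_map by blast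
    qed
  qed
  show "gline \<delta> ` set (map edge_frame ico_edge_list) \<subseteq> Lconf \<delta>"
  proof
    fix A assume "A \<in> gline \<delta> ` set (map edge_frame ico_edge_list)"
    then obtain x y where xy: "(x, y) \<in> set ico_edge_list" and A: "A = gline \<delta> (edge_frame (x, y))"
      by (auto simp del: gline.simps edge_frame.simps)
    have "gdot (gvsub x y) (gvsub x y) = (8, -4)"
      using xy by (auto simp: ico_edge_list_def)
    then have "gval (gdot (gvsub x y) (gvsub x y)) = 8 - 4 * gold" by (simp del: gval_dot)
    then have "dist (vval x) (vval y) = 2 / gold" using edge_dist_iff by blast
    then have "(vval x, vval y) \<in> ico_edges"
      using in_ico_edge_list(1,2)[OF xy] by (auto simp: ico_edges_def ico_vertices_eq)
    then show "A \<in> Lconf \<delta>"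
      unfolding Lconf_def A rotated_edge_line_eq[OF xy, symmetric] by blast
  qed
qed

text \<open>By Lagrange's identity \<open>N\<close> is the squared norm of the cross product of the
  directions, and \<open>W\<close> is twice the triple product, whence the factor 4. A nonzero
  triple product excludes parallel directions, so positivity of \<open>N\<close> comes for
  free.\<close>

lemma setdist_gline:
  fixes \<delta> :: real
  assumes f: "f \<in> set (map edge_frame ico_edge_list)" and f': "f' \<in> set (map edge_frame ico_edge_list)"
  defines "W \<equiv> gform (Wform f f') (cos \<delta>) (sin \<delta>)"
  defines "N \<equiv> (8 - 4 * gold)\<^sup>2 - (gform (Eform f f') (cos \<delta>) (sin \<delta>))\<^sup>2"
  shows "N \<noteq> 0 \<Longrightarrow> (setdist (gline \<delta> f) (gline \<delta> f'))\<^sup>2 = W\<^sup>2 / (4 * N)"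
    and "W \<noteq> 0 \<Longrightarrow> N > 0"
proof -
  obtain x y where xy: "(x, y) \<in> set ico_edge_list" and fe: "f = edge_frame (x, y)" using f by auto
  obtain x' y' where xy': "(x', y') \<in> set ico_edge_list" and fe': "f' = edge_frame (x', y')" using f' by auto
  define a b where "a = vval x - vval y" and "b = cross3 (vval y) (vval x)"
  define a' b' where "a' = vval x' - vval y'" and "b' = cross3 (vval y') (vval x')"
  define m m' where "m = vval x + vval y" and "m' = vval x' + vval y'"
  define D where "D = cos \<delta> *\<^sub>R a + sin \<delta> *\<^sub>R b"
  define D' where "D' = cos \<delta> *\<^sub>R a' + sin \<delta> *\<^sub>R b'"
  have l: "gline \<delta> f = {(1/2) *\<^sub>R m + t *\<^sub>R D | t. True}"
    by (simp add: fe a_def b_def m_def D_def)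
  have l': "gline \<delta> f' = {(1/2) *\<^sub>R m' + t *\<^sub>R D' | t. True}"
    by (simp add: fe' a'_def b'_def m'_def D'_def)
  have "W = (cos \<delta>)\<^sup>2 * ((m - m') \<bullet> cross3 a a') + (cos \<delta> * sin \<delta>) * ((m - m') \<bullet> (cross3 a b' + cross3 b a'))
      + (sin \<delta>)\<^sup>2 * ((m - m') \<bullet> cross3 b b')"
    by (simp add: W_def fe fe' a_def b_def a'_def b'_def m_def m'_def)
  also have "\<dots> = (m - m') \<bullet> cross3 D D'"
    unfolding D_def D'_def
    by (simp add: cross_add_left cross_add_right cross_mult_left cross_mult_right inner_add_right
        power2_eq_square algebra_simps)
  finally have W: "W = (m - m') \<bullet> cross3 D D'" .
  have E: "gform (Eform f f') (cos \<delta>) (sin \<delta>) = D \<bullet> D'"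
    by (simp add: fe fe' a_def[symmetric] b_def[symmetric] a'_def[symmetric] b'_def[symmetric]
        D_def D'_def inner_add_left inner_add_right power2_eq_square algebra_simps)
  have nD: "(norm D)\<^sup>2 = 8 - 4 * gold"
    unfolding D_def a_def b_def gline_direction_norm[OF xy] by simp
  have nD': "(norm D')\<^sup>2 = 8 - 4 * gold"
    unfolding D'_def a'_def b'_def gline_direction_norm[OF xy'] by simp
  have N: "N = (norm (cross3 D D'))\<^sup>2"
    unfolding N_def E norm_cross nD nD' by (simp add: power2_eq_square)
  show "W \<noteq> 0 \<Longrightarrow> N > 0" unfolding W N by auto
  show "(setdist (gline \<delta> f) (gline \<delta> f'))\<^sup>2 = W\<^sup>2 / (4 * N)" if "N \<noteq> 0"
  proof -
    have "cross3 D D' \<noteq> 0" using that N by auto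
    then have "setdist (gline \<delta> f) (gline \<delta> f')
        = \<bar>((1/2) *\<^sub>R m - (1/2) *\<^sub>R m') \<bullet> cross3 D D'\<bar> / norm (cross3 D D')"
      unfolding l l' by (rule setdist_lines)
    also have "((1/2) *\<^sub>R m - (1/2) *\<^sub>R m') \<bullet> cross3 D D' = W / 2"
      unfolding W by (simp add: inner_diff_left algebra_simps)
    finally show ?thesis unfolding N by (simp add: power_divide power_mult_distrib)
  qed
qed

section \<open>The minimal distance\<close>

lemma dmin_le:
  assumes "A \<in> Lconf \<delta>" "B \<in> Lconf \<delta>" "A \<noteq> B"
  shows "dmin \<delta> \<le> setdist A B"
  unfolding dmin_def
  by (rule cInf_lower) (use assms in \<open>auto intro!: bdd_belowI[of _ 0] setdist_pos_le\<close>)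

section \<open>Polynomial inequalities for the two critical pairs of lines\<close>

lemma cubic_balance:
  assumes "cubic t = 0"
  shows "(1 - t)\<^sup>2 * ((9 * gold + 6) + (20 * gold + 14) * t + (11 * gold + 7) * t\<^sup>2) = 4 * t * (1 + t + t\<^sup>2)"
proof -
  have "(1 - t)\<^sup>2 * ((9 * gold + 6) + (20 * gold + 14) * t + (11 * gold + 7) * t\<^sup>2) - 4 * t * (1 + t + t\<^sup>2)
      = (t + 1) * cubic t"
    unfolding cubic_def by algebra
  then show ?thesis using assms by simp
qed

text \<open>The comparison of \<open>f\<^sub>1(y / x)\<close> with the common value at
  \<open>t\<close>, made homogeneous in \<open>x = cos\<^sup>2 \<delta>\<close> and
  \<open>y = sin\<^sup>2 \<delta>\<close> so that a vanishing cosine needs no separate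
  treatment.\<close>

lemma adjacent_form_bound:
  assumes t: "0.6943558 < t" "t < 0.6943559" "cubic t = 0" and xy: "0 \<le> x" "0 \<le> y"
    and or: "y \<le> t * x \<or> x \<le> t * y"
  shows "4 * x * y * (1 + t + t\<^sup>2)
    \<le> (1 - t)\<^sup>2 * ((9 * gold + 6) * x\<^sup>2 + (20 * gold + 14) * (x * y) + (11 * gold + 7) * y\<^sup>2)"
    (is "?L \<le> (1 - t)\<^sup>2 * ?G")
proof -
  let ?K = "(9 * gold + 6) + (20 * gold + 14) * t + (11 * gold + 7) * t\<^sup>2"
  have "t * t \<le> 0.6943559 * 0.6943559" using t by (intro mult_mono) auto
  then have "(11 * gold + 7) * (t * t) \<le> (11 * gold + 7) * (0.6943559 * 0.6943559)"
    using gold_bounds by (intro mult_left_mono) auto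
  also have "\<dots> \<le> 9 * gold + 6" using gold_bounds by simp
  finally have gt: "(11 * gold + 7) * (t * t) \<le> 9 * gold + 6" .
  \<comment> \<open>After clearing denominators the difference vanishes at \<open>y = t * x\<close>.
    The ratio \<open>y / x\<close> of the other linear factor's zero lies between \<open>t\<close>
    and \<open>1 / t\<close>, so both factors have the same sign outside that interval.\<close>
  have "0 \<le> (y - t * x) * ((11 * gold + 7) * t * y - (9 * gold + 6) * x)"
    using or
  proof
    assume a: "y \<le> t * x"
    have "(11 * gold + 7) * t * y \<le> (11 * gold + 7) * t * (t * x)"
      using a t gold_bounds by (intro mult_left_mono) auto
    also have "\<dots> = (11 * gold + 7) * (t * t) * x" by simp
    also have "\<dots> \<le> (9 * gold + 6) * x" using gt xy by (intro mult_right_mono)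
    finally show ?thesis using a by (intro mult_nonpos_nonpos) auto
  next
    assume a: "x \<le> t * y"
    have "(9 * gold + 6) * x \<le> (11 * gold + 7) * x"
      using xy gold_bounds by (intro mult_right_mono) auto
    also have "\<dots> \<le> (11 * gold + 7) * (t * y)" using a gold_bounds by (intro mult_left_mono) auto
    finally have 1: "(9 * gold + 6) * x \<le> (11 * gold + 7) * t * y" by simp
    have "t * y \<le> y" "t * x \<le> x"
      using mult_right_mono[of t 1 y] mult_right_mono[of t 1 x] t xy by simp_all
    then have "t * x \<le> y" using a by simp
    with 1 show ?thesis by (intro mult_nonneg_nonneg) auto
  qed
  also have "\<dots> = t * ?G - x * y * ?K" by (simp add: power2_eq_square algebra_simps)
  finally have "x * y * ?K \<le> t * ?G" by simp
  then have "(1 - t)\<^sup>2 * (x * y * ?K) \<le> (1 - t)\<^sup>2 * (t * ?G)" by (rule mult_left_mono) simp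
  moreover have "(1 - t)\<^sup>2 * (x * y * ?K) = x * y * ((1 - t)\<^sup>2 * ?K)" by (simp only: ac_simps)
  ultimately have "x * y * (4 * t * (1 + t + t\<^sup>2)) \<le> (1 - t)\<^sup>2 * (t * ?G)"
    unfolding cubic_balance[OF t(3)] by simp
  then have "t * ?L \<le> t * ((1 - t)\<^sup>2 * ?G)" by (simp only: ac_simps)
  then show ?thesis using t by simp
qed

text \<open>Both sides are symmetric in \<open>x\<close> and \<open>y\<close> and agree at
  \<open>y = t * x\<close>, hence also at \<open>x = t * y\<close>; this forces the factorization of
  the difference.\<close>

lemma orthogonal_form_bound:
  fixes t x y :: real
  assumes "t * x \<le> y" "t * y \<le> x"
  shows "(x - y)\<^sup>2 * (1 + t + t\<^sup>2) \<le> (1 - t)\<^sup>2 * (x\<^sup>2 + x * y + y\<^sup>2)"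
proof -
  have "(1 - t)\<^sup>2 * (x\<^sup>2 + x * y + y\<^sup>2) - (x - y)\<^sup>2 * (1 + t + t\<^sup>2) = 3 * ((y - t * x) * (x - t * y))"
    by algebra
  moreover have "0 \<le> (y - t * x) * (x - t * y)" using assms by (intro mult_nonneg_nonneg) auto
  ultimately show ?thesis by linarith
qed

text \<open>The factor \<open>34 - 21 * gold\<close> is \<open>gold\<close> to the power -8; it
  cancels against the same factor in \<open>adjacent_form_sq\<close>, leaving
  \<open>f\<^sub>1\<close>.\<close>

lemma adjacent_form_eq:
  "(8 - 4 * gold)\<^sup>2 * (x + y)\<^sup>2 - ((4 - 2 * gold) * x + (4 * gold - 6) * y)\<^sup>2
   = 4 * (34 - 21 * gold) * ((9 * gold + 6) * x\<^sup>2 + (20 * gold + 14) * (x * y) + (11 * gold + 7) * y\<^sup>2)"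
  using gold_sq by algebra

lemma adjacent_form_sq: "(24 * gold - 40)\<^sup>2 = 64 * (34 - 21 * gold)"
  using gold_sq by algebra

text \<open>Edges with midpoints \<open>(0, 0, 1)\<close>, \<open>(1, 0, 0)\<close> and \<open>(1, 1 / gold, gold) / 2\<close>; the last one shares a
  vertex with the first.\<close>

definition frame0 :: gframe where
  "frame0 = edge_frame (((0, 0), (-1, 1), (1, 0)), ((0, 0), (1, -1), (1, 0)))"
definition frame1 :: gframe where
  "frame1 = edge_frame (((1, 0), (0, 0), (-1, 1)), ((1, 0), (0, 0), (1, -1)))"
definition frame2 :: gframe where
  "frame2 = edge_frame (((0, 0), (-1, 1), (1, 0)), ((1, 0), (0, 0), (-1, 1)))"

lemma frames_mem:
  "frame0 \<in> set (map edge_frame ico_edge_list)" "frame1 \<in> set (map edge_frame ico_edge_list)"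
  "frame2 \<in> set (map edge_frame ico_edge_list)"
  by code_simp+

lemma frame_forms:
  "Wform frame0 frame1 = ((-16, 8), (0, 0), (16, -8))" "Eform frame0 frame1 = ((0, 0), (-8, 4), (0, 0))"
  "Wform frame0 frame2 = ((0, 0), (-40, 24), (0, 0))" "Eform frame0 frame2 = ((4, -2), (0, 0), (-6, 4))"
  by code_simp+

text \<open>The line of \<open>frame0\<close> stays in the plane \<open>z = 1\<close>, tangent to
  the sphere at its midpoint, while the midpoints of the other two edges have height 0 and
  \<open>gold / 2\<close>.\<close>

lemma glines_distinct: "gline \<delta> frame0 \<noteq> gline \<delta> frame1" "gline \<delta> frame0 \<noteq> gline \<delta> frame2"
proof -
  have z: "p $ 3 = 1" if p: "p \<in> gline \<delta> frame0" for p
    using p by (auto simp: frame0_def cross3_def)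
  have mem: "(1/2) *\<^sub>R vval m \<in> gline \<delta> (m, a, b)" for m a b
    by (auto intro!: exI[of _ 0])
  obtain m a b where f1: "frame1 = (m, a, b)" by (metis prod_cases3)
  have "((1/2) *\<^sub>R vval m) $ 3 = 0" using f1 by (auto simp: frame1_def)
  then have "(1/2) *\<^sub>R vval m \<notin> gline \<delta> frame0" using z[of "(1/2) *\<^sub>R vval m"] by linarith
  then show "gline \<delta> frame0 \<noteq> gline \<delta> frame1" using mem[of m a b] unfolding f1 by metis
  obtain m a b where f2: "frame2 = (m, a, b)" by (metis prod_cases3)
  have "((1/2) *\<^sub>R vval m) $ 3 = gold / 2" using f2 by (auto simp: frame2_def)
  then have "((1/2) *\<^sub>R vval m) $ 3 < 1" using gold_bounds by simp
  then have "(1/2) *\<^sub>R vval m \<notin> gline \<delta> frame0" using z[of "(1/2) *\<^sub>R vval m"] by linarith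
  then show "gline \<delta> frame0 \<noteq> gline \<delta> frame2" using mem[of m a b] unfolding f2 by metis
qed

definition dsq :: "real \<Rightarrow> real" where "dsq t = (1 - t)\<^sup>2 / (1 + t + t\<^sup>2)"

lemma dmin_upper:
  assumes t: "0.6943558 < t" "t < 0.6943559" "cubic t = 0"
  shows "dmin \<delta> \<le> sqrt (dsq t)"
proof -
  define x y where "x = (cos \<delta>)\<^sup>2" and "y = (sin \<delta>)\<^sup>2"
  have xy: "0 \<le> x" "0 \<le> y" "x + y = 1" by (simp_all add: x_def y_def)
  have tau: "1 + t + t\<^sup>2 > 0" using t by (simp add: add_pos_nonneg)
  note L = frames_mem[THEN imageI, of "gline \<delta>", folded Lconf_eq]
  show ?thesis
  \<comment> \<open>The cases say whether the squared tangent lies outside the open interval from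
    \<open>t\<close> to \<open>1 / t\<close>; outside, \<open>frame2\<close> supplies the close
    line, inside, \<open>frame1\<close>.\<close>
  proof (cases "y \<le> t * x \<or> x \<le> t * y")
    case True
    define G where "G = (9 * gold + 6) * x\<^sup>2 + (20 * gold + 14) * (x * y) + (11 * gold + 7) * y\<^sup>2"
    define h where "h = 34 - 21 * gold"
    have h: "h > 0" using gold_bounds by (simp add: h_def)
    have "0 < x\<^sup>2 + y\<^sup>2" using xy by (auto simp: sum_power2_gt_zero_iff)
    moreover have "1 * x\<^sup>2 \<le> (9 * gold + 6) * x\<^sup>2" "1 * y\<^sup>2 \<le> (11 * gold + 7) * y\<^sup>2"
      using gold_bounds by (intro mult_right_mono; simp)+
    moreover have "0 \<le> (20 * gold + 14) * (x * y)"
      using gold_bounds xy by (intro mult_nonneg_nonneg) auto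
    ultimately have G: "G > 0" unfolding G_def by linarith
    have W: "(gform (Wform frame0 frame2) (cos \<delta>) (sin \<delta>))\<^sup>2 = 64 * h * (x * y)"
      using adjacent_form_sq by (simp add: frame_forms x_def y_def h_def power_mult_distrib)
    have N: "(8 - 4 * gold)\<^sup>2 - (gform (Eform frame0 frame2) (cos \<delta>) (sin \<delta>))\<^sup>2 = 4 * h * G"
      using adjacent_form_eq[of x y] xy(3) by (simp add: frame_forms x_def y_def h_def G_def)
    have "(setdist (gline \<delta> frame0) (gline \<delta> frame2))\<^sup>2 = 64 * h * (x * y) / (4 * (4 * h * G))"
      using setdist_gline(1)[OF frames_mem(1,3), of \<delta>] h G unfolding W N by simp
    also have "\<dots> = 4 * x * y / G" using h G by (simp add: field_simps)
    also have "\<dots> \<le> dsq t"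
    proof -
      have "4 * x * y * (1 + t + t\<^sup>2) \<le> (1 - t)\<^sup>2 * G"
        unfolding G_def by (rule adjacent_form_bound[OF t xy(1,2) True])
      then show ?thesis unfolding dsq_def using tau G by (simp add: field_simps)
    qed
    finally have "setdist (gline \<delta> frame0) (gline \<delta> frame2) \<le> sqrt (dsq t)" by (rule real_le_rsqrt)
    then show ?thesis using dmin_le[OF L(1,3) glines_distinct(2)] by linarith
  next
    case False
    have S: "x\<^sup>2 + x * y + y\<^sup>2 > 0"
    proof -
      have "0 < x\<^sup>2 + y\<^sup>2" using xy by (auto simp: sum_power2_gt_zero_iff)
      moreover have "0 \<le> x * y" using xy by simp
      ultimately show ?thesis by linarith
    qed
    \<comment> \<open>This is \<open>4 * (8 - 4 * gold)\<^sup>2\<close>, the common factor of the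
      squared triple product and of the denominator.\<close>
    define h where "h = 64 * (2 - gold)\<^sup>2"
    have h: "h > 0" using gold_bounds by (simp add: h_def)
    have W: "(gform (Wform frame0 frame1) (cos \<delta>) (sin \<delta>))\<^sup>2 = h * (x - y)\<^sup>2"
    proof -
      have "gform (Wform frame0 frame1) (cos \<delta>) (sin \<delta>) = -8 * (2 - gold) * (x - y)"
        by (simp add: frame_forms x_def y_def algebra_simps)
      then show ?thesis by (simp only: h_def power_mult_distrib) simp
    qed
    have "(gform (Eform frame0 frame1) (cos \<delta>) (sin \<delta>))\<^sup>2 = (-8 + 4 * gold)\<^sup>2 * (x * y)"
      by (simp add: frame_forms x_def y_def power_mult_distrib)
    \<comment> \<open>The constant 1 is written as \<open>(x + y)\<^sup>2\<close> to make the
      denominator homogeneous.\<close>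
    then have "4 * ((8 - 4 * gold)\<^sup>2 - (gform (Eform frame0 frame1) (cos \<delta>) (sin \<delta>))\<^sup>2)
        = h * ((x + y)\<^sup>2 - x * y)"
      unfolding xy(3) h_def by (simp add: power2_eq_square algebra_simps)
    also have "\<dots> = h * (x\<^sup>2 + x * y + y\<^sup>2)" by (simp add: power2_eq_square algebra_simps)
    finally have N: "4 * ((8 - 4 * gold)\<^sup>2 - (gform (Eform frame0 frame1) (cos \<delta>) (sin \<delta>))\<^sup>2)
        = h * (x\<^sup>2 + x * y + y\<^sup>2)" .
    then have "(8 - 4 * gold)\<^sup>2 - (gform (Eform frame0 frame1) (cos \<delta>) (sin \<delta>))\<^sup>2 \<noteq> 0"
      using h S by auto
    from setdist_gline(1)[OF frames_mem(1,2) this]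
    have "(setdist (gline \<delta> frame0) (gline \<delta> frame1))\<^sup>2 = h * (x - y)\<^sup>2 / (h * (x\<^sup>2 + x * y + y\<^sup>2))"
      unfolding W N .
    also have "\<dots> = (x - y)\<^sup>2 / (x\<^sup>2 + x * y + y\<^sup>2)" using h by simp
    also have "\<dots> \<le> dsq t"
      unfolding dsq_def using orthogonal_form_bound[of t x y] False tau S
      by (simp add: divide_le_eq field_simps)
    finally have "setdist (gline \<delta> frame0) (gline \<delta> frame1) \<le> sqrt (dsq t)" by (rule real_le_rsqrt)
    then show ?thesis using dmin_le[OF L(1,2) glines_distinct(1)] by linarith
  qed
qed

section \<open>Lower bound for all pairs at the optimal angle\<close>

lemma dsq_bounds:
  assumes t: "0.6943558 < t" "t < 0.6943559"
  shows "0.0429216 < dsq t" "dsq t < 0.04292167"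
proof -
  have tt: "0.6943558 * 0.6943558 < t * t" "t * t < 0.6943559 * 0.6943559"
    by (rule mult_strict_mono; use t in simp)+
  have tau: "1 + t + t\<^sup>2 > 0" using t by (simp add: add_pos_nonneg)
  have "0.0429216 * (1 + t + t\<^sup>2) < (1 - t)\<^sup>2" "(1 - t)\<^sup>2 < 0.04292167 * (1 + t + t\<^sup>2)"
  proof -
    have q: "(1 - 0.6943559)\<^sup>2 < (1 - t)\<^sup>2" "(1 - t)\<^sup>2 < (1 - 0.6943558)\<^sup>2"
      by (rule power_strict_mono; use t in simp)+
    show "0.0429216 * (1 + t + t\<^sup>2) < (1 - t)\<^sup>2"
      using q(1) t(2) tt(2) by (simp add: power2_eq_square[of t] power_divide)
    show "(1 - t)\<^sup>2 < 0.04292167 * (1 + t + t\<^sup>2)"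
      using q(2) t(1) tt(1) by (simp add: power2_eq_square[of t] power_divide)
  qed
  then show "0.0429216 < dsq t" "dsq t < 0.04292167"
    using tau by (simp_all only: dsq_def pos_less_divide_eq pos_divide_less_eq)
qed

text \<open>With \<open>w\<close> and \<open>e\<close> the two forms divided by \<open>cos\<^sup>2 \<delta>\<close>, the squared distance at \<open>tan\<^sup>2 \<delta> = t\<close> is
  \<open>w\<^sup>2\<close> divided by \<open>4 ((8 - 4 gold)\<^sup>2 (1 + t)\<^sup>2 - e\<^sup>2)\<close>.\<close>

lemma class_bound:
  assumes t: "0.6943558 < t" "t < 0.6943559" "cubic t = 0"
    and mem: "(W, E) \<in> set pair_classes"
  defines "w \<equiv> gform W 1 (sqrt t)" and "e \<equiv> gform E 1 (sqrt t)"
  shows "w \<noteq> 0 \<and> 4 * dsq t * ((8 - 4 * gold)\<^sup>2 * (1 + t)\<^sup>2 - e\<^sup>2) \<le> w\<^sup>2"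
proof -
  define T where "T = sqrt t"
  have Tt: "T\<^sup>2 = t" using t by (simp add: T_def)
  have tau: "1 + t + t\<^sup>2 > 0" using t by (simp add: add_pos_nonneg)
  have T: "0.83328 < T" "T < 0.8332803"
    unfolding T_def by (rule real_less_rsqrt, use t in \<open>simp add: power2_eq_square\<close>)
      (rule real_less_lsqrt, use t in \<open>simp_all add: power2_eq_square\<close>)
  \<comment> \<open>With these products bounded, \<open>w\<close> and \<open>e\<close> become linear
    in the quantities \<open>gold\<close>, \<open>T\<close>, \<open>t\<close>,
    \<open>gold * T\<close> and \<open>gold * t\<close>.\<close>
  have gT: "1.61803398 * 0.83328 < gold * T" "gold * T < 1.61803399 * 0.8332803"
    by (rule mult_strict_mono; use T gold_bounds in simp)+
  have gt: "1.61803398 * 0.6943558 < gold * t" "gold * t < 1.61803399 * 0.6943559"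
    by (rule mult_strict_mono; use t gold_bounds in simp)+
  note F = dsq_bounds[OF t(1,2)]
  have size: "(8 - 4 * gold) * (1 + t) < 2.5889" "0 < (8 - 4 * gold) * (1 + t)"
    using gt t gold_bounds by (simp_all add: algebra_simps)
  then have S: "(8 - 4 * gold)\<^sup>2 * (1 + t)\<^sup>2 < 2.5889\<^sup>2"
    unfolding power_mult_distrib[symmetric] by (intro power_strict_mono) auto
  \<comment> \<open>Even with \<open>e\<^sup>2\<close> dropped the left side stays below 1.2, so a
    form of absolute value at least 2 leaves ample room.\<close>
  have big: ?thesis if b: "\<bar>w\<bar> \<ge> 2"
  proof -
    have "4 * dsq t * ((8 - 4 * gold)\<^sup>2 * (1 + t)\<^sup>2 - e\<^sup>2) \<le> 4 * dsq t * 2.5889\<^sup>2"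
    proof (rule mult_left_mono)
      show "(8 - 4 * gold)\<^sup>2 * (1 + t)\<^sup>2 - e\<^sup>2 \<le> 2.5889\<^sup>2"
        using S zero_le_power2[of e] by linarith
    qed (use F in simp)
    also have "\<dots> \<le> 4 * 0.043 * 2.5889\<^sup>2" using F by (intro mult_right_mono) auto
    also have "\<dots> \<le> 2\<^sup>2" by (simp add: power2_eq_square)
    also have "\<dots> \<le> w\<^sup>2" using power_mono[OF b, of 2] by simp
    finally show ?thesis using b by auto
  qed
  have w: "w = gform W 1 T" and e: "e = gform E 1 T" by (simp_all add: w_def e_def T_def)
  consider
      "W = ((0, 0), (40, -24), (0, 0))" "E = ((4, -2), (0, 0), (-6, 4))"
    | "W = ((16, -8), (0, 0), (-16, 8))" "E = ((0, 0), (8, -4), (0, 0))"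
    | "W = ((24, -16), (-24, 16), (-24, 16))" "E = ((2, -2), (12, -8), (-4, 2))"
    | "W \<in> {((0, 0), (8, 0), (0, 0)), ((0, 0), (16, -8), (0, 0)), ((0, 0), (64, -32), (0, 0)),
        ((8, -8), (-8, 8), (-8, 8)), ((8, -8), (8, -8), (-8, 8)), ((16, -8), (-32, 24), (-16, 8)),
        ((16, -8), (32, -24), (-16, 8)), ((24, -16), (24, -16), (-24, 16))}"
    using mem unfolding pair_classes_def list.set by (elim insertE emptyE; simp)
  then show ?thesis
  proof cases
    case 1
    \<comment> \<open>This class and the next are the minimising pairs, and for both the inequality
      is an equality: here by \<open>cubic_balance\<close>, there by the formula for
      \<open>dsq\<close>.\<close>
    have "w = - (24 * gold - 40) * T" unfolding w 1 by (simp add: algebra_simps)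
    then have w2: "w\<^sup>2 = 64 * (34 - 21 * gold) * t"
      using adjacent_form_sq by (simp add: power_mult_distrib Tt power2_commute)
    have e': "e = (4 - 2 * gold) * 1 + (4 * gold - 6) * t" unfolding e 1 by (simp add: Tt algebra_simps)
    let ?K = "(9 * gold + 6) + (20 * gold + 14) * t + (11 * gold + 7) * t\<^sup>2"
    have "dsq t * ?K = 4 * t"
      using cubic_balance[OF t(3)] tau by (simp add: dsq_def)
    moreover have "4 * dsq t * ((8 - 4 * gold)\<^sup>2 * (1 + t)\<^sup>2 - e\<^sup>2) = 16 * (34 - 21 * gold) * (dsq t * ?K)"
      unfolding e' adjacent_form_eq by (simp add: algebra_simps)
    ultimately have "4 * dsq t * ((8 - 4 * gold)\<^sup>2 * (1 + t)\<^sup>2 - e\<^sup>2) = w\<^sup>2"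
      unfolding w2 by (simp only:)
    moreover have "w\<^sup>2 > 0" unfolding w2 using t gold_bounds by simp
    ultimately show ?thesis by auto
  next
    case 2
    have w': "w = 2 * (8 - 4 * gold) * (1 - t)" unfolding w 2 by (simp add: Tt algebra_simps)
    have e': "e = (8 - 4 * gold) * T" unfolding e 2 by simp
    have "(8 - 4 * gold)\<^sup>2 * (1 + t)\<^sup>2 - e\<^sup>2 = (8 - 4 * gold)\<^sup>2 * (1 + t + t\<^sup>2)"
      unfolding e' power_mult_distrib Tt by (simp add: power2_eq_square algebra_simps)
    then have "4 * dsq t * ((8 - 4 * gold)\<^sup>2 * (1 + t)\<^sup>2 - e\<^sup>2) = 4 * (8 - 4 * gold)\<^sup>2 * (1 - t)\<^sup>2"
      using tau by (simp add: dsq_def)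
    also have "\<dots> = w\<^sup>2" unfolding w' by (simp only: power_mult_distrib) simp
    finally show ?thesis using t gold_bounds by (auto simp: w')
  next
    case 3
    \<comment> \<open>Here \<open>w\<close> is slightly below 1, too small for the crude estimate;
      but the lines are nearly parallel, so \<open>e\<^sup>2\<close> cancels most of the first
      term.\<close>
    have w': "\<bar>w\<bar> \<ge> 0.98" unfolding w 3 using T gT gt t gold_bounds by (simp add: Tt algebra_simps)
    have e': "\<bar>e\<bar> \<ge> 2.54" unfolding e 3 using T gT gt t gold_bounds by (simp add: Tt algebra_simps)
    have "2.54\<^sup>2 \<le> e\<^sup>2" using power_mono[OF e', of 2] by simp
    then have "(8 - 4 * gold)\<^sup>2 * (1 + t)\<^sup>2 - e\<^sup>2 \<le> 0.3" using S by (simp add: power2_eq_square)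
    then have "4 * dsq t * ((8 - 4 * gold)\<^sup>2 * (1 + t)\<^sup>2 - e\<^sup>2) \<le> 4 * dsq t * 0.3"
      using F by (intro mult_left_mono) auto
    also have "\<dots> \<le> 0.98\<^sup>2" using F by (simp add: power2_eq_square)
    also have "\<dots> \<le> w\<^sup>2" using power_mono[OF w', of 2] by simp
    finally show ?thesis using w' by auto
  next
    case 4
    then have "\<bar>w\<bar> \<ge> 2"
      by (elim insertE emptyE) (use T gT gt t gold_bounds in \<open>simp_all add: w Tt algebra_simps\<close>)
    then show ?thesis by (rule big)
  qed
qed

lemma gform_gneg: "gform (gneg W) c s = - gform W c s"
  by (cases W rule: prod_cases3) (simp del: gsub.simps add: algebra_simps)

lemma gform_scale: "gform W c (T * c) = c\<^sup>2 * gform W 1 T"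
  by (cases W rule: prod_cases3) (simp add: power2_eq_square algebra_simps)

text \<open>Writing the sine as \<open>sqrt t\<close> times the cosine pulls the squared cosine out
  of both forms; \<open>all_in_class\<close> then reduces every pair to
  \<open>class_bound\<close>.\<close>

lemma dmin_lower:
  assumes t: "0.6943558 < t" "t < 0.6943559" "cubic t = 0"
  shows "sqrt (dsq t) \<le> dmin (arctan (sqrt t))"
proof -
  define \<delta> where "\<delta> = arctan (sqrt t)"
  define c where "c = cos \<delta>"
  have c: "c > 0" by (simp add: c_def \<delta>_def cos_arctan add_pos_nonneg)
  have s: "sin \<delta> = sqrt t * c" by (simp add: c_def \<delta>_def cos_arctan sin_arctan)
  have c2: "c\<^sup>2 * (1 + t) = 1" using t by (simp add: c_def \<delta>_def cos_arctan power_divide)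
  have key: "sqrt (dsq t) \<le> setdist (gline \<delta> f) (gline \<delta> f')"
    if ff: "(f, f') \<in> set (pairs (map edge_frame ico_edge_list))" for f f'
  proof -
    have "in_class (f, f')" using all_in_class ff by (auto simp only: list_all_iff)
    then obtain W0 E0 where WE: "(W0, E0) \<in> set pair_classes"
      and W0: "Wform f f' = W0 \<or> gneg (Wform f f') = W0"
      and E0: "Eform f f' = E0 \<or> gneg (Eform f f') = E0"
      by (auto simp: in_class_def Let_def list_ex_iff)
    define w e where "w = gform W0 1 (sqrt t)" and "e = gform E0 1 (sqrt t)"
    have b: "w \<noteq> 0" "4 * dsq t * ((8 - 4 * gold)\<^sup>2 * (1 + t)\<^sup>2 - e\<^sup>2) \<le> w\<^sup>2"
      using class_bound[OF t WE] by (auto simp: w_def e_def)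
    let ?W = "gform (Wform f f') (cos \<delta>) (sin \<delta>)" and ?E = "gform (Eform f f') (cos \<delta>) (sin \<delta>)"
    have "?W = c\<^sup>2 * w \<or> ?W = - (c\<^sup>2 * w)"
      using W0 unfolding s c_def[symmetric] gform_scale w_def by (auto simp: gform_gneg)
    then have W: "?W\<^sup>2 = (c\<^sup>2)\<^sup>2 * w\<^sup>2" and Wn: "?W \<noteq> 0"
      using c b(1) by (auto simp: power_mult_distrib)
    have "?E = c\<^sup>2 * e \<or> ?E = - (c\<^sup>2 * e)"
      using E0 unfolding s c_def[symmetric] gform_scale e_def by (auto simp: gform_gneg)
    then have E: "?E\<^sup>2 = (c\<^sup>2)\<^sup>2 * e\<^sup>2" by (auto simp: power_mult_distrib)
    define N where "N = (8 - 4 * gold)\<^sup>2 - ?E\<^sup>2"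
    \<comment> \<open>Inserting the square of \<open>c\<^sup>2 * (1 + t) = 1\<close> lets the power
      of \<open>c\<close> factor out of both terms.\<close>
    have "N = (8 - 4 * gold)\<^sup>2 * (c\<^sup>2 * (1 + t))\<^sup>2 - (c\<^sup>2)\<^sup>2 * e\<^sup>2" unfolding N_def E c2 by simp
    also have "\<dots> = (c\<^sup>2)\<^sup>2 * ((8 - 4 * gold)\<^sup>2 * (1 + t)\<^sup>2 - e\<^sup>2)"
      by (simp only: power_mult_distrib right_diff_distrib mult.left_commute)
    finally have N: "N = (c\<^sup>2)\<^sup>2 * ((8 - 4 * gold)\<^sup>2 * (1 + t)\<^sup>2 - e\<^sup>2)" .
    have f: "f \<in> set (map edge_frame ico_edge_list)" "f' \<in> set (map edge_frame ico_edge_list)"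
      using set_pairs[OF ff] by blast+
    have Np: "N > 0" using setdist_gline(2)[OF f Wn] by (simp add: N_def)
    have "dsq t * (4 * N) \<le> ?W\<^sup>2"
      using mult_left_mono[OF b(2) zero_le_power2[of "c\<^sup>2"]] unfolding W N by (simp only: ac_simps)
    then have "dsq t \<le> ?W\<^sup>2 / (4 * N)" using Np by (simp add: pos_le_divide_eq)
    also have "\<dots> = (setdist (gline \<delta> f) (gline \<delta> f'))\<^sup>2"
      using setdist_gline(1)[OF f, of \<delta>] Np by (simp add: N_def)
    finally show ?thesis by (intro real_le_lsqrt setdist_pos_le)
  qed
  have "sqrt (dsq t) \<le> setdist A B" if AB: "A \<in> Lconf \<delta>" "B \<in> Lconf \<delta>" "A \<noteq> B" for A B
  proof -
    obtain f f' where f: "f \<in> set (map edge_frame ico_edge_list)" "A = gline \<delta> f"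
      and f': "f' \<in> set (map edge_frame ico_edge_list)" "B = gline \<delta> f'"
      using AB unfolding Lconf_eq by blast
    have "f \<noteq> f'" using AB(3) f f' by blast
    from pairs_complete[OF f(1) f'(1) this] show ?thesis
      using key f(2) f'(2) setdist_sym by metis
  qed
  \<comment> \<open>A lower bound for the members bounds \<open>Inf\<close> only if the set of
    distances is nonempty.\<close>
  moreover have "{setdist A B |A B. A \<in> Lconf \<delta> \<and> B \<in> Lconf \<delta> \<and> A \<noteq> B} \<noteq> {}"
    using frames_mem[THEN imageI, of "gline \<delta>", folded Lconf_eq] glines_distinct(1)[of \<delta>] by blast
  ultimately show ?thesis
    unfolding dmin_def \<delta>_def[symmetric] by (intro cInf_greatest) auto
qed

theorem theorem2:
  shows "(\<forall>z::complex. poly (map_poly complex_of_real P0) z = 0 \<longrightarrow> z \<in> \<real>) \<and>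
    (\<exists>t0::real. poly P0 t0 = 0 \<and> \<bar>t0 - 0.694356\<bar> < 0.000001 \<and>
      (let \<delta>max = arctan (sqrt t0); d = dmin \<delta>max in
        \<delta>max \<in> {0 .. pi / 2} \<and>
        (\<forall>\<delta>\<in>{0 .. pi / 2}. dmin \<delta> \<le> d) \<and>
        \<bar>\<delta>max - 0.694707\<bar> < 0.000001 \<and>
        \<bar>d\<^sup>2 - 0.0429216\<bar> < 0.0000001 \<and>
        \<bar>d / (2 - d) - 0.115558\<bar> < 0.000001))"
proof (intro conjI allI impI)
  show "z \<in> \<real>" if "poly (map_poly complex_of_real P0) z = 0" for z
    using that by (rule P0_roots_real)
next
  obtain t where t: "0.6943558 < t" "t < 0.6943559" "cubic t = 0" using cubic_root by blast
  have d: "dmin (arctan (sqrt t)) = sqrt (dsq t)"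
    using dmin_lower[OF t] dmin_upper[OF t] by (intro antisym)
  note F = dsq_bounds[OF t(1,2)]
  have sq: "(sqrt (dsq t))\<^sup>2 = dsq t" using F by simp
  have l: "0.207175 < sqrt (dsq t)"
    by (rule real_less_rsqrt) (use F in \<open>simp add: power2_eq_square\<close>)
  have u: "sqrt (dsq t) < 0.207176"
    by (rule real_less_lsqrt) (use F in \<open>simp_all add: power2_eq_square\<close>)
  have r: "\<bar>sqrt (dsq t) / (2 - sqrt (dsq t)) - 0.115558\<bar> < 0.000001"
  proof -
    have "sqrt (dsq t) / (2 - sqrt (dsq t)) < 0.115559"
      using l u by (subst pos_divide_less_eq) (simp_all add: algebra_simps)
    moreover have "sqrt (dsq t) / (2 - sqrt (dsq t)) > 0.115557"
      using l u by (subst pos_less_divide_eq) (simp_all add: algebra_simps)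
    ultimately show ?thesis by linarith
  qed
  show "\<exists>t0::real. poly P0 t0 = 0 \<and> \<bar>t0 - 0.694356\<bar> < 0.000001 \<and>
      (let \<delta>max = arctan (sqrt t0); d = dmin \<delta>max in
        \<delta>max \<in> {0 .. pi / 2} \<and>
        (\<forall>\<delta>\<in>{0 .. pi / 2}. dmin \<delta> \<le> d) \<and>
        \<bar>\<delta>max - 0.694707\<bar> < 0.000001 \<and>
        \<bar>d\<^sup>2 - 0.0429216\<bar> < 0.0000001 \<and>
        \<bar>d / (2 - d) - 0.115558\<bar> < 0.000001)"
    unfolding Let_def
  proof (intro exI[of _ t] conjI)
    show "poly P0 t = 0" using t(3) by (rule cubic_root_imp_P0)
    show "\<bar>t - 0.694356\<bar> < 0.000001" using t by (simp add: abs_less_iff)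
    show "arctan (sqrt t) \<in> {0..pi / 2}"
      using t arctan_ubound[of "sqrt t"] by simp
    show "\<forall>\<delta>\<in>{0..pi / 2}. dmin \<delta> \<le> dmin (arctan (sqrt t))"
      unfolding d using dmin_upper[OF t] by blast
    show "\<bar>arctan (sqrt t) - 0.694707\<bar> < 0.000001" using t(1,2) by (rule arctan_bounds)
    show "\<bar>(dmin (arctan (sqrt t)))\<^sup>2 - 0.0429216\<bar> < 0.0000001"
      unfolding d sq using F by (simp add: abs_less_iff)
    show "\<bar>dmin (arctan (sqrt t)) / (2 - dmin (arctan (sqrt t))) - 0.115558\<bar> < 0.000001"
      unfolding d by (rule r)
  qed
qed

end
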